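(* Let $n,m$ be positive integers. Write $n=am+b$ with integers $a>0$ and $0<b<m$, and set $d=a+b$ and $k=\lfloor n/d\rfloor$. Let $\Delta$ be the regular configuration in $\mathrm{CONF}(a,b)$, and fix a reading of $\Delta$ as in the context. Then the cycles $C_{0,\Delta}, C_{m-1,\Delta}, C_{2(m-1),\Delta},\dots,C_{(k-1)(m-1),\Delta}$ in $\mathrm{Shift}(n,m)$ are pairwise vertex-disjoint.
   Context: $\mathrm{Shift}(n,m)$ is the directed graph with vertex set $\mathbb{Z}_n=\{0,\dots,n-1\}$ and arcs $i\to i+1$ and $i\to i+m$ (mod $n$). $\mathrm{CONF}(a,b)$ is the set of necklaces (circular arrangements up to rotation) of $a$ red and $b$ black beads. For a necklace with black beads $B_0,\dots,B_{b-1}$ in cyclic order, its characteristic sequence $\{x_0,\dots,x_{b-1}\}$ lists the number $x_i$ of red beads between $B_i$ and $B_{i+1}$. The necklace is regular if $\frac{a}{b}k'-1<x_i+\dots+x_{i+k'-1}<\frac{a}{b}k'+1$ for all $0\le i\le b-1$ and $1\le k'\le 1+\lfloor b/2\rfloor$ (indices mod $b$). There is a unique regular configuration in $\mathrm{CONF}(a,b)$. Fix a reading of $\Delta$: the beads $\beta_0,\dots,\beta_{d-1}$ encountered in cyclic order starting from some bead. Set $l_p=m$ if $\beta_p$ is red and $l_p=1$ if $\beta_p$ is black, so that $l_0+\dots+l_{d-1}=am+b=n$. For $v\in\mathbb{Z}_n$, $C_{v,\Delta}$ is the directed cycle of $\mathrm{Shift}(n,m)$ with vertex sequence $v,\ v+l_0,\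 v+l_0+l_1,\ \dots,\ v+l_0+\dots+l_{d-2}$ (mod $n$). The same reading is used for all $v$. *)

theory Defs
  imports Complex_Main "Graph_Theory.Graph_Theory"
begin

definition Shift :: "nat \<Rightarrow> nat \<Rightarrow> nat pair_pre_digraph" where
  "Shift n m = \<lparr> pverts = {0..<n},
     parcs = {(i, (i + 1) mod n) | i. i < n} \<union> {(i, (i + m) mod n) | i. i < n} \<rparr>"

datatype bead = Red | Black

definition bead_words :: "nat \<Rightarrow> nat \<Rightarrow> bead list set" where
  "bead_words a b = {w. count_list w Red = a \<and> count_list w Black = b}"

definition rotation_rel :: "(bead list \<times> bead list) set" where
  "rotation_rel = {(u, w). \<exists>j. w = rotate j u}"

text \<open>A necklace is a rotation class of bead words; its elements are exactly its readings.\<close>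

definition CONF :: "nat \<Rightarrow> nat \<Rightarrow> bead list set set" where
  "CONF a b = bead_words a b // rotation_rel"

text \<open>The word read off starting at the black bead \<open>B\<^sub>0\<close> is
  \<open>B\<^sub>0\<close>, then \<open>x\<^sub>0\<close> red beads, then \<open>B\<^sub>1\<close>, then \<open>x\<^sub>1\<close> red beads, and so on.  The sequence \<open>x\<close>
  is determined by the necklace up to the choice of \<open>B\<^sub>0\<close>, i.e. up to rotation.\<close>

definition characteristic_sequence :: "bead list set \<Rightarrow> nat list \<Rightarrow> bool" where
  "characteristic_sequence N x \<longleftrightarrow> concat (map (\<lambda>r. Black # replicate r Red) x) \<in> N"

text \<open>The inequalities range over all cyclic windows, so they hold for one characteristic
  sequence of the necklace iff they hold for all of them.\<close>

definition regular_necklace :: "nat \<Rightarrow> nat \<Rightarrow> bead list set \<Rightarrow> bool" where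
  "regular_necklace a b N \<longleftrightarrow> (\<exists>x. characteristic_sequence N x \<and>
     (\<forall>i \<in> {0..b - 1}. \<forall>k' \<in> {1..1 + b div 2}.
        real a / real b * real k' - 1 < real (\<Sum>j<k'. x ! ((i + j) mod b)) \<and>
        real (\<Sum>j<k'. x ! ((i + j) mod b)) < real a / real b * real k' + 1))"

fun bead_step :: "nat \<Rightarrow> bead \<Rightarrow> nat" where
  "bead_step m Red = m"
| "bead_step m Black = 1"

definition cycle_verts :: "nat \<Rightarrow> nat \<Rightarrow> nat \<Rightarrow> bead list \<Rightarrow> nat list" where
  "cycle_verts n m v \<beta> =
     map (\<lambda>p. (v + (\<Sum>q<p. bead_step m (\<beta> ! q))) mod n) [0..<length \<beta>]"

text \<open>Arcs between consecutive vertices, including the closing arc from the last to the first.\<close>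

definition cycle_arcs :: "nat \<Rightarrow> nat \<Rightarrow> nat \<Rightarrow> bead list \<Rightarrow> (nat \<times> nat) list" where
  "cycle_arcs n m v \<beta> = zip (cycle_verts n m v \<beta>) (rotate1 (cycle_verts n m v \<beta>))"

end

theory Submission
  imports Defs
begin

text \<open>
  Regularity says that every arc of the necklace with \<open>r\<close> red and \<open>s\<close> black beads satisfies
  \<open>\<bar>r b - s a\<bar> < d\<close>.  A common vertex of two of the cycles yields such an arc (up to sign) with
  \<open>r m + s \<equiv> t (m - 1)\<close> modulo \<open>n\<close>, where \<open>0 < t < k\<close>.  Solving this congruence gives
  \<open>r b - s a = t d + u n\<close> for an integer \<open>u\<close>; since \<open>d \<le> t d \<le> n - d\<close>, this has absolute value
  at least \<open>d\<close>.
\<close>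

section \<open>Discrepancy of prefixes of a bead word\<close>

text \<open>Indices are reduced modulo the length, so the count extends past the end of the word and
  arcs that wrap around are differences of prefixes.\<close>

definition red_count :: "bead list \<Rightarrow> nat \<Rightarrow> int" where
  "red_count w p = (\<Sum>q<p. of_bool (w ! (q mod length w) = Red))"

text \<open>In a word with \<open>a\<close> red and \<open>b\<close> black beads this is \<open>r b - s a\<close>, where \<open>r\<close> and \<open>s\<close> are
  the numbers of red and black beads among the first \<open>p\<close>.\<close>

definition discrepancy :: "bead list \<Rightarrow> nat \<Rightarrow> int" where
  "discrepancy w p = int (length w) * red_count w p - int (count_list w Red) * int p"

lemma sum_lessThan_shift:
  fixes g :: "nat \<Rightarrow> 'a::comm_monoid_add"
  shows "(\<Sum>j<i + k. g j) = (\<Sum>j<i. g j) + (\<Sum>j<k. g (i + j))"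
  by (induction k) (simp_all add: add.assoc)

lemma count_list_take_eq_sum:
  "p \<le> length w \<Longrightarrow> int (count_list (take p w) c) = (\<Sum>q<p. of_bool (w ! q = c))"
  by (induction p) (auto simp: take_Suc_conv_app_nth)

lemma red_count_eq_count_list:
  assumes "p \<le> length w"
  shows "red_count w p = int (count_list (take p w) Red)"
  unfolding red_count_def count_list_take_eq_sum[OF assms]
  using assms by (intro sum.cong) auto

lemma discrepancy_0: "discrepancy w 0 = 0"
  by (simp add: discrepancy_def red_count_def)

lemma discrepancy_length: "discrepancy w (length w) = 0"
  by (simp add: discrepancy_def red_count_eq_count_list)

lemma red_count_add_length:
  "red_count w (length w + p) = int (count_list w Red) + red_count w p"
  using red_count_eq_count_list[of "length w" w]
  unfolding red_count_def sum_lessThan_shift by simp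

lemma discrepancy_add_length: "discrepancy w (length w + p) = discrepancy w p"
  unfolding discrepancy_def red_count_add_length by (simp add: algebra_simps)

lemma discrepancy_mod: "discrepancy w p = discrepancy w (p mod length w)"
proof -
  have "discrepancy w (length w * c + q) = discrepancy w q" for q c
    by (induction c) (simp_all add: add.assoc discrepancy_add_length)
  from this[of "p div length w" "p mod length w"] show ?thesis by simp
qed

lemma count_list_rotate: "count_list (rotate j w) c = count_list w c"
proof -
  have "count_list (rotate1 w) c = count_list w c" for w by (cases w) auto
  then show ?thesis by (induction j) simp_all
qed

text \<open>Rotation changes all prefix discrepancies by the same constant, so a bound on the
  difference between any two positions passes from one reading to all the others.\<close>

lemma discrepancy_rotate:
  "discrepancy (rotate j w) p = discrepancy w (j + p) - discrepancy w j"
proof (cases "w = []")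
  case False
  then have "red_count (rotate j w) p = red_count w (j + p) - red_count w j"
    unfolding red_count_def sum_lessThan_shift by (simp add: nth_rotate mod_add_right_eq)
  then show ?thesis
    unfolding discrepancy_def count_list_rotate by (simp add: right_diff_distrib distrib_left)
qed (simp add: discrepancy_def red_count_def)

section \<open>Block words and the bounds given by regularity\<close>

abbreviation blocks :: "nat list \<Rightarrow> bead list" where
  "blocks x \<equiv> concat (map (\<lambda>r. Black # replicate r Red) x)"

lemma count_list_replicate: "count_list (replicate r c) c' = (if c = c' then r else 0)"
  by (induction r) auto

lemma count_list_blocks:
  "count_list (blocks x) Red = sum_list x" "count_list (blocks x) Black = length x"
  by (induction x) (auto simp: count_list_replicate)

text \<open>The witness \<open>i\<close> is the block containing the last bead of the prefix: the
  black beads of blocks \<open>0\<close> to \<open>i\<close> have been passed, and the red beads of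
  block \<open>i\<close> only in part.\<close>

lemma blocks_prefix:
  assumes "0 < p" "p \<le> length (blocks x)"
  shows "\<exists>i<length x. p = Suc i + count_list (take p (blocks x)) Red \<and>
    sum_list (take i x) \<le> count_list (take p (blocks x)) Red \<and>
    count_list (take p (blocks x)) Red \<le> sum_list (take (Suc i) x)"
  using assms
proof (induction x arbitrary: p)
  case (Cons r x)
  show ?case
  proof (cases "p \<le> Suc r")
    case True
    then have "count_list (take p (blocks (r # x))) Red = p - 1"
      using \<open>0 < p\<close> by (cases p) (auto simp: count_list_replicate)
    then show ?thesis using True \<open>0 < p\<close> by (intro exI[of _ 0]) auto
  next
    case False
    define p' where "p' = p - Suc r"
    have p: "p = Suc r + p'" and "0 < p'" using False by (auto simp: p'_def)
    have c: "count_list (take p (blocks (r # x))) Red = r + count_list (take p' (blocks x)) Red"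
      by (simp add: p count_list_replicate)
    have "p' \<le> length (blocks x)" using Cons.prems p by simp
    from Cons.IH[OF \<open>0 < p'\<close> this] obtain i where "i < length x"
      "p' = Suc i + count_list (take p' (blocks x)) Red"
      "sum_list (take i x) \<le> count_list (take p' (blocks x)) Red"
      "count_list (take p' (blocks x)) Red \<le> sum_list (take (Suc i) x)" by blast
    then show ?thesis unfolding c by (intro exI[of _ "Suc i"]) (use p in auto)
  qed
qed simp

text \<open>Regularity only bounds windows of length at most \<open>1 + b div 2\<close>; the remaining windows are
  complements of such.\<close>

lemma regular_window_bound:
  fixes x :: "nat list"
  assumes b: "length x = b" "0 < b" and a: "sum_list x = a"
    and reg: "\<forall>i \<in> {0..b - 1}. \<forall>k' \<in> {1..1 + b div 2}.
        real a / real b * real k' - 1 < real (\<Sum>j<k'. x ! ((i + j) mod b)) \<and>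
        real (\<Sum>j<k'. x ! ((i + j) mod b)) < real a / real b * real k' + 1"
    and ij: "i \<le> j" "j \<le> b"
  shows "\<bar>int b * (int (sum_list (take j x)) - int (sum_list (take i x))) - int a * (int j - int i)\<bar> < int b"
proof -
  \<comment> \<open>\<open>Y\<close> continues periodically past \<open>b\<close>, so that a
    wrapping window is also a difference of two prefix sums.\<close>
  define Y where "Y i = (\<Sum>j<i. x ! (j mod b))" for i
  have Y: "Y i = sum_list (take i x)" if "i \<le> b" for i
    using that b by (auto simp: Y_def sum_list_sum_nth atLeast0LessThan min_def intro!: sum.cong)
  have window: "Y (i + k) = Y i + (\<Sum>j<k. x ! ((i + j) mod b))" for i k
    by (simp add: Y_def sum_lessThan_shift)
  have Yb: "Y b = a" using Y[of b] a b by simp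
  have Y_add: "Y (b + i) = a + Y i" for i
    by (simp add: window Yb) (simp add: Y_def)
  have short: "\<bar>int b * (int (Y (i + k)) - int (Y i)) - int a * int k\<bar> < int b"
    if "1 \<le> k" "k \<le> 1 + b div 2" "i \<le> b" for i k
  proof -
    \<comment> \<open>The start \<open>i = b\<close> lies outside the range of \<open>reg\<close>;
      reducing it modulo \<open>b\<close> leaves the window unchanged.\<close>
    have sm: "(i mod b + j) mod b = (i + j) mod b" for j by (simp add: mod_add_left_eq)
    have "i mod b \<in> {0..b - 1}" "k \<in> {1..1 + b div 2}"
      using that mod_less_divisor[OF b(2), of i] by auto
    from reg[rule_format, OF this]
    have "real a / real b * real k - 1 < real (Y (i + k)) - real (Y i) \<and>
      real (Y (i + k)) - real (Y i) < real a / real b * real k + 1"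
      unfolding sm by (simp add: window)
    then have "real a * real k - real b < real b * (real (Y (i + k)) - real (Y i))"
      "real b * (real (Y (i + k)) - real (Y i)) < real a * real k + real b"
      using b by (simp_all add: field_simps)
    then have "\<bar>real_of_int (int b * (int (Y (i + k)) - int (Y i)) - int a * int k)\<bar> < real_of_int (int b)"
      by simp
    then show ?thesis by linarith
  qed
  have "\<bar>int b * (int (Y j) - int (Y i)) - int a * (int j - int i)\<bar> < int b"
  proof (cases "j - i = 0 \<or> j - i \<le> 1 + b div 2")
    case True
    then show ?thesis using short[of "j - i" i] ij b by (cases "i = j") (auto simp: of_nat_diff)
  next
    case False
    \<comment> \<open>The complementary window runs from \<open>j\<close> to \<open>b + i\<close>. A
      full turn has expression \<open>0\<close>, so the two expressions are negatives of each other;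
      \<open>k = 0\<close> is the full turn itself.\<close>
    define k where "k = b - (j - i)"
    have jk: "j + k = b + i" and k: "k \<le> 1 + b div 2" using ij False by (auto simp: k_def)
    show ?thesis
    proof (cases "k = 0")
      case True
      then have "i = 0" "j = b" using ij jk by auto
      then show ?thesis using Yb b by (simp add: Y_def)
    next
      case False
      have ik: "int k = int b + int i - int j" using jk by linarith
      from short[of k j] False k ij have "\<bar>int b * (int (Y (b + i)) - int (Y j)) - int a * int k\<bar> < int b"
        by (simp add: jk)
      moreover have "int b * (int (Y (b + i)) - int (Y j)) - int a * int k =
        - (int b * (int (Y j) - int (Y i)) - int a * (int j - int i))"
        unfolding ik Y_add by (simp add: algebra_simps)
      ultimately show ?thesis by simp
    qed
  qed
  then show ?thesis using ij by (simp add: Y)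
qed

text \<open>The red beads between positions in blocks \<open>i \<le> i'\<close> number at most the
  sum over blocks \<open>i\<close> to \<open>i'\<close> and at least the sum over the blocks
  strictly between. Each window is off by less than \<open>b\<close>, and its length differs from
  \<open>i' - i\<close> by one, which costs a further \<open>a\<close>.\<close>

lemma regular_blocks_discrepancy:
  assumes b: "length x = b" "0 < b" and a: "sum_list x = a"
    and reg: "\<forall>i \<in> {0..b - 1}. \<forall>k' \<in> {1..1 + b div 2}.
        real a / real b * real k' - 1 < real (\<Sum>j<k'. x ! ((i + j) mod b)) \<and>
        real (\<Sum>j<k'. x ! ((i + j) mod b)) < real a / real b * real k' + 1"
    and len: "length (blocks x) = a + b"
  shows "\<bar>discrepancy (blocks x) p - discrepancy (blocks x) q\<bar> < int (a + b)"
proof -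
  define X where "X i = int (sum_list (take i x))" for i
  have bound: "\<bar>int b * (X j - X i) - int a * (int j - int i)\<bar> < int b" if "i \<le> j" "j \<le> b" for i j
    unfolding X_def by (rule regular_window_bound[OF b a reg that])
  have repr: "\<exists>i r. i < b \<and> discrepancy (blocks x) p = int b * r - int a * (int i + 1) \<and>
      X i \<le> r \<and> r \<le> X (Suc i)" for p
  proof -
    \<comment> \<open>A multiple of the length is represented by the full turn instead of
      \<open>0\<close>, because \<open>blocks_prefix\<close> needs a last bead.\<close>
    define p' where "p' = (if p mod (a + b) = 0 then a + b else p mod (a + b))"
    have eq: "discrepancy (blocks x) p = discrepancy (blocks x) p'"
      using discrepancy_mod[of "blocks x" p] discrepancy_length[of "blocks x"]
        discrepancy_0[of "blocks x"] by (auto simp: p'_def len)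
    have "0 < p'" and le: "p' \<le> length (blocks x)"
      using b mod_less_divisor[of "a + b" p] unfolding p'_def len by auto
    from blocks_prefix[OF this] obtain i where i: "i < b"
      "p' = Suc i + count_list (take p' (blocks x)) Red"
      "X i \<le> int (count_list (take p' (blocks x)) Red)"
      "int (count_list (take p' (blocks x)) Red) \<le> X (Suc i)"
      unfolding X_def b by (auto simp only: of_nat_le_iff)
    define r where "r = int (count_list (take p' (blocks x)) Red)"
    have p': "int p' = int i + 1 + r" using i(2) unfolding r_def by linarith
    have "discrepancy (blocks x) p' = int (a + b) * r - int a * int p'"
      unfolding discrepancy_def red_count_eq_count_list[OF le] len count_list_blocks a r_def ..
    then have "discrepancy (blocks x) p' = int b * r - int a * (int i + 1)"
      unfolding p' by (simp add: algebra_simps)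
    then show ?thesis using i eq unfolding r_def by auto
  qed
  have diff: "\<bar>(int b * r' - int a * (int i' + 1)) - (int b * r - int a * (int i + 1))\<bar> < int (a + b)"
    if "i \<le> i'" "i' < b" "X i \<le> r" "r \<le> X (Suc i)" "X i' \<le> r'" "r' \<le> X (Suc i')" for i i' r r'
  proof -
    have "int b * (r' - r) \<le> int b * (X (Suc i') - X i)"
      using that by (intro mult_left_mono) auto
    moreover have "\<bar>int b * (X (Suc i') - X i) - int a * (int (Suc i') - int i)\<bar> < int b"
      using that by (intro bound) auto
    moreover have "int b * (r' - r) - int a * (int i' - int i) > - int (a + b)"
    proof -
      have "int b * (X i' - X (Suc i)) \<le> int b * (r' - r)"
        using that by (intro mult_left_mono) auto
      moreover have "\<bar>int b * (X i' - X (Suc i)) - int a * (int i' - int (Suc i))\<bar> < int b"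
      \<comment> \<open>Within a single block the inner window has length \<open>-1\<close>: it is
        the block itself counted negatively.\<close>
      proof (cases "i = i'")
        case True
        then show ?thesis using bound[of i "Suc i"] that by (simp add: algebra_simps abs_if split: if_splits)
      next
        case False
        then show ?thesis using that by (intro bound) auto
      qed
      ultimately show ?thesis by (simp add: algebra_simps)
    qed
    ultimately show ?thesis by (simp add: algebra_simps)
  qed
  obtain i r where 1: "i < b" "discrepancy (blocks x) p = int b * r - int a * (int i + 1)"
      "X i \<le> r" "r \<le> X (Suc i)" using repr by blast
  obtain i' r' where 2: "i' < b" "discrepancy (blocks x) q = int b * r' - int a * (int i' + 1)"
      "X i' \<le> r'" "r' \<le> X (Suc i')" using repr by blast
  show ?thesis
  proof (cases "i \<le> i'")
    case True
    from diff[OF this 2(1) 1(3,4) 2(3,4)] show ?thesis unfolding 1 2 by linarith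
  next
    case False
    with diff[of i' i r' r] 1 2 show ?thesis by simp
  qed
qed

section \<open>Readings of a regular necklace\<close>

lemma count_list_Red_Black: "count_list w Red + count_list w Black = length w"
proof (induction w)
  case (Cons c w)
  then show ?case by (cases c) auto
qed simp

text \<open>The reading \<open>w\<close> and the block word witnessing regularity are rotations of
  one representative \<open>u\<close>, hence of each other.\<close>

lemma regular_necklace_discrepancy:
  assumes "0 < b" and "N \<in> CONF a b" and "regular_necklace a b N" and "w \<in> N"
  shows "count_list w Red = a" "length w = a + b"
    "\<bar>discrepancy w p - discrepancy w q\<bar> < int (a + b)"
proof -
  obtain u where u: "u \<in> bead_words a b" "N = rotation_rel `` {u}"
    using assms(2) unfolding CONF_def by (auto elim: quotientE)
  have rot: "\<exists>j. w = rotate j u" if "w \<in> N" for w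
    using that u by (auto simp: rotation_rel_def)
  have cnt: "count_list w Red = a" "count_list w Black = b" if "w \<in> N" for w
    using rot[OF that] u by (auto simp: bead_words_def count_list_rotate)
  have len: "length w = a + b" if "w \<in> N" for w
    using count_list_Red_Black[of w] cnt[OF that] by simp
  show "count_list w Red = a" "length w = a + b" using cnt len assms(4) by auto
  obtain x where x: "blocks x \<in> N" and reg: "\<forall>i \<in> {0..b - 1}. \<forall>k' \<in> {1..1 + b div 2}.
        real a / real b * real k' - 1 < real (\<Sum>j<k'. x ! ((i + j) mod b)) \<and>
        real (\<Sum>j<k'. x ! ((i + j) mod b)) < real a / real b * real k' + 1"
    using assms(3) unfolding regular_necklace_def characteristic_sequence_def by blast
  obtain i j where i: "blocks x = rotate i u" and j: "w = rotate j u"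
    using rot x assms(4) by blast
  have "length u = a + b" using len[OF x] i by (metis length_rotate)
  \<comment> \<open>Rotating by \<open>(length u - 1) * i\<close> more undoes a rotation by
    \<open>i\<close>, since the total is a multiple of the length.\<close>
  then have "(length u - 1) * i + i = length u * i" using assms(1)
    by (metis Nat.add_0_right add.commute add_is_0 less_numeral_extra(3) mult_eq_if)
  then have "u = rotate ((length u - 1) * i) (blocks x)"
    unfolding i rotate_rotate by (simp add: rotate_id)
  then have w: "w = rotate (j + (length u - 1) * i) (blocks x)"
    unfolding j by (metis rotate_rotate)
  have "length x = b" "sum_list x = a" using cnt[OF x] count_list_blocks by simp_all
  from regular_blocks_discrepancy[OF this(1) assms(1) this(2) reg len[OF x]]
  show "\<bar>discrepancy w p - discrepancy w q\<bar> < int (a + b)"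
    unfolding w discrepancy_rotate by simp
qed

section \<open>Bead steps and cycles of the shift graph\<close>

text \<open>Every bead advances by \<open>1\<close> and a red one by a further \<open>m - 1\<close>,
  the same unit by which the starting vertices are spaced.\<close>

lemma sum_bead_step:
  assumes "p \<le> length w"
  shows "int (\<Sum>q<p. bead_step m (w ! q)) = int p + (int m - 1) * red_count w p"
proof -
  have "int (bead_step m c) = 1 + (int m - 1) * of_bool (c = Red)" for c
    by (cases c) auto
  then have "int (\<Sum>q<p. bead_step m (w ! q)) =
      (\<Sum>q<p. 1 + (int m - 1) * of_bool (w ! q = Red))" by simp
  also have "\<dots> = (\<Sum>q<p. 1 + (int m - 1) * of_bool (w ! (q mod length w) = Red))"
    using assms by (intro sum.cong) auto
  finally show ?thesis by (simp add: red_count_def sum.distrib sum_distrib_left)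
qed

text \<open>For \<open>z = x\<close> the second list is \<open>rotate1 (x # xs)\<close>, which gives
  the closed walk; the end is kept separate because the start changes in the induction.\<close>

lemma cas_awalk_verts_zip:
  "pre_digraph.cas (with_proj G) x (zip (x # xs) (xs @ [z])) z"
  "pre_digraph.awalk_verts (with_proj G) x (zip (x # xs) (xs @ [z])) = x # xs @ [z]"
  by (induction xs arbitrary: x) (auto simp: pre_digraph.cas.simps pre_digraph.awalk_verts.simps)

lemma cycle_zip_rotate1:
  assumes "vs \<noteq> []" "distinct vs" "set vs \<subseteq> pverts G" "set (zip vs (rotate1 vs)) \<subseteq> parcs G"
  shows "pre_digraph.cycle (with_proj G) (zip vs (rotate1 vs))"
proof -
  obtain x xs where vs: "vs = x # xs" using assms(1) by (cases vs) auto
  show ?thesis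
    using assms cas_awalk_verts_zip[of G x xs x]
    unfolding pre_digraph.cycle_def pre_digraph.awalk_def vs by (auto intro!: exI[of _ x])
qed

text \<open>The partial sums increase strictly from \<open>0\<close> and stay below \<open>n\<close>
  before the last step, so the vertices are distinct; the total \<open>n\<close> closes the
  cycle.\<close>

lemma cycle_cycle_arcs:
  assumes len: "0 < length w" and m: "0 < m" and n: "(\<Sum>q<length w. bead_step m (w ! q)) = n"
  shows "pre_digraph.cycle (with_proj (Shift n m)) (cycle_arcs n m v w)"
  unfolding cycle_arcs_def
proof (rule cycle_zip_rotate1)
  let ?S = "\<lambda>p. \<Sum>q<p. bead_step m (w ! q)" and ?vs = "cycle_verts n m v w"
  have pos: "0 < bead_step m c" for c using m by (cases c) auto
  have mono: "?S p < ?S q" if "p < q" for p q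
    by (rule lift_Suc_mono_less[of ?S, OF _ that]) (simp add: pos)
  have n0: "0 < n" using mono[OF len] n by simp
  have lenvs: "length ?vs = length w" by (simp add: cycle_verts_def)
  have nth: "?vs ! p = (v + ?S p) mod n" if "p < length w" for p
    using that by (simp add: cycle_verts_def)
  show "?vs \<noteq> []" using len lenvs by auto
  have less: "?S p < n" if "p < length w" for p using mono[OF that] n by simp
  show "distinct ?vs"
  proof -
    have "(v + ?S p) mod n \<noteq> (v + ?S q) mod n" if "p < q" "q < length w" for p q
    proof
      assume "(v + ?S p) mod n = (v + ?S q) mod n"
      then have "n dvd ?S q - ?S p"
        using mod_eq_dvd_iff_nat[of "v + ?S p" "v + ?S q" n] mono[OF that(1)] by simp
      moreover have "0 < ?S q - ?S p" using mono[OF that(1)] by simp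
      ultimately show False using less[OF that(2)] by (meson dvd_imp_le leD less_imp_diff_less)
    qed
    then show ?thesis unfolding distinct_conv_nth lenvs
      by (metis (no_types, lifting) linorder_neqE_nat nth)
  qed
  show "set ?vs \<subseteq> pverts (Shift n m)"
    using n0 by (auto simp: cycle_verts_def Shift_def)
  show "set (zip ?vs (rotate1 ?vs)) \<subseteq> parcs (Shift n m)"
  proof
    fix e assume "e \<in> set (zip ?vs (rotate1 ?vs))"
    then obtain p where p: "p < length w" and e: "e = (?vs ! p, rotate1 ?vs ! p)"
      by (auto simp: set_zip lenvs)
    have "rotate1 ?vs ! p = ?vs ! (Suc p mod length w)" using p by (simp add: nth_rotate1 lenvs)
    also have "\<dots> = (v + ?S (Suc p)) mod n"
    \<comment> \<open>The last arc ends at \<open>v + n\<close>, which is the first vertex modulo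
      \<open>n\<close>.\<close>
    proof (cases "Suc p = length w")
      case True
      then show ?thesis using nth[of 0] n len by (simp add: True[symmetric])
    next
      case False
      then show ?thesis using p by (subst nth) auto
    qed
    also have "\<dots> = (?vs ! p + bead_step m (w ! p)) mod n"
      using p by (simp add: nth mod_add_left_eq add.assoc)
    finally have "e = (?vs ! p, (?vs ! p + bead_step m (w ! p)) mod n)" using e by simp
    moreover have "?vs ! p < n" using p n0 by (simp add: nth)
    ultimately show "e \<in> parcs (Shift n m)"
      by (cases "w ! p") (auto simp: Shift_def)
  qed
qed

section \<open>Disjointness of the shifted cycles\<close>

theorem theorem7:
  fixes n m a b d k :: nat and \<Delta> :: "bead list set" and \<beta> :: "bead list"
  assumes "n > 0" and "m > 0"
    and "n = a * m + b" and "a > 0" and "0 < b" and "b < m"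
    and "d = a + b" and "k = n div d"
    and "\<Delta> \<in> CONF a b" and "regular_necklace a b \<Delta>"
    and "\<beta> \<in> \<Delta>"
  shows "(\<forall>j<k. pre_digraph.cycle (with_proj (Shift n m)) (cycle_arcs n m (j * (m - 1)) \<beta>)) \<and>
         disjoint_family_on (\<lambda>j. set (cycle_verts n m (j * (m - 1)) \<beta>)) {..<k}"
proof
  note regular = regular_necklace_discrepancy[OF \<open>0 < b\<close> assms(9-11)]
  let ?S = "\<lambda>p. \<Sum>q<p. bead_step m (\<beta> ! q)"
  have len: "length \<beta> = d" using regular(2) assms by simp
  have "int (?S (length \<beta>)) = int n"
    using sum_bead_step[of "length \<beta>" \<beta> m] regular(1,2) \<open>n = a * m + b\<close>
    by (simp add: red_count_eq_count_list algebra_simps)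
  then have total: "?S (length \<beta>) = n" by linarith
  show "\<forall>j<k. pre_digraph.cycle (with_proj (Shift n m)) (cycle_arcs n m (j * (m - 1)) \<beta>)"
    using cycle_cycle_arcs[OF _ \<open>m > 0\<close> total] len assms by simp
  have distinct_verts: "(i * (m - 1) + ?S p) mod n \<noteq> (j * (m - 1) + ?S q) mod n"
    if "i < j" "j < k" "p < d" "q < d" for i j p q
  proof
    assume "(i * (m - 1) + ?S p) mod n = (j * (m - 1) + ?S q) mod n"
    then have "int (i * (m - 1) + ?S p) mod int n = int (j * (m - 1) + ?S q) mod int n"
      by (metis of_nat_mod)
    then have "int n dvd int (i * (m - 1) + ?S p) - int (j * (m - 1) + ?S q)"
      by (simp only: mod_eq_dvd_iff)
    then obtain c where c: "int (i * (m - 1) + ?S p) - int (j * (m - 1) + ?S q) = int n * c"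
      by (elim dvdE)
    define t where "t = int j - int i"
    define r where "r = red_count \<beta> p - red_count \<beta> q"
    define s where "s = int p - int q - r"
    \<comment> \<open>The solutions of \<open>r * m + s = t * (m - 1) + c * n\<close> are
      \<open>(r, s) = t (1, -1) + c (a, b) + u (1, -m)\<close>. The form
      \<open>b * r - a * s\<close> takes the values \<open>d\<close>, \<open>0\<close> and
      \<open>n\<close> on these three vectors.\<close>
    define u where "u = r - t - c * int a"
    have S: "int (?S p) = int p + (int m - 1) * red_count \<beta> p"
      "int (?S q) = int q + (int m - 1) * red_count \<beta> q"
      using sum_bead_step that len by simp_all
    have m1: "int (m - 1) = int m - 1" using \<open>m > 0\<close> by (simp add: of_nat_diff)
    have "int (i * (m - 1) + ?S p) - int (j * (m - 1) + ?S q) = r * int m + s - t * (int m - 1)"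
      unfolding of_nat_add of_nat_mult m1 S t_def r_def s_def by (simp add: algebra_simps)
    with c have "r * int m + s - t * (int m - 1) = int n * c" by simp
    then have s: "s = c * int b - t - u * int m"
      unfolding u_def \<open>n = a * m + b\<close> by (simp add: algebra_simps)
    have r: "r = u + t + c * int a" by (simp add: u_def)
    have "discrepancy \<beta> p - discrepancy \<beta> q = int b * r - int a * s"
      unfolding discrepancy_def regular(1,2) s_def r_def by (simp add: algebra_simps)
    also have "\<dots> = t * int d + u * int n"
      unfolding s r \<open>d = a + b\<close> \<open>n = a * m + b\<close> by (simp add: algebra_simps)
    finally have small: "\<bar>t * int d + u * int n\<bar> < int d" using regular(3)[of p q] assms by simp
    have "1 \<le> t" "t \<le> int k - 1" using that by (auto simp: t_def)
    then have "1 * int d \<le> t * int d" "t * int d \<le> (int k - 1) * int d"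
      by (simp_all add: mult_right_mono del: mult_1)
    moreover have "int k * int d \<le> int n"
      unfolding \<open>k = n div d\<close> by (metis of_nat_le_iff of_nat_mult div_times_less_eq_dividend)
    ultimately have td: "int d \<le> t * int d" "t * int d \<le> int n - int d"
      by (simp_all add: algebra_simps)
    show False
    proof (cases "0 \<le> u")
      case True
      then show False using td(1) small mult_nonneg_nonneg[of u "int n"] by linarith
    next
      case False
      then have "u * int n \<le> (-1) * int n" by (intro mult_right_mono) auto
      then show False using td(2) small by linarith
    qed
  qed
  have "set (cycle_verts n m (i * (m - 1)) \<beta>) \<inter> set (cycle_verts n m (j * (m - 1)) \<beta>) = {}"
    if "i < j" "j < k" for i j
    using distinct_verts[OF that] by (auto simp: cycle_verts_def len)
  then show "disjoint_family_on (\<lambda>j. set (cycle_verts n m (j * (m - 1)) \<beta>)) {..<k}"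
    unfolding disjoint_family_on_def by (metis Int_commute lessThan_iff linorder_neqE_nat)
qed

end
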